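(* Let $a_{ij},a_i\in\mathbb{Z}$, $i=1,\ldots,m$, $j=1,\ldots,k$, be arbitrary integers. Let $S\subset\mathbb{N}^k$ be the set of solutions $(x_1,\ldots,x_k)$ in nonnegative integers of the system of Diophantine inequalities \[ a_{i1}x_1+\cdots+a_{ik}x_k+a_i\ge 0,\qquad i=1,\ldots,m. \] Then the characteristic series $\chi_S(t_1,\ldots,t_k)$ of $S$ is a nice rational function.
   Context: $\mathbb{N}$ denotes the set of nonnegative integers (including $0$). For a set $P\subset\mathbb{N}^k$, its characteristic series is the formal power series $\chi_P(t_1,\ldots,t_k)=\sum_{p=(p_1,\ldots,p_k)\in P}t_1^{p_1}\cdots t_k^{p_k}$. A nice rational function is a rational function (polynomial numerator in $t_1,\ldots,t_k$) whose denominator is a product of factors of the form $1-t_1^{\alpha_1}\cdots t_k^{\alpha_k}$, where $(\alpha_1,\ldots,\alpha_k)\in\mathbb{N}^k$ is nonzero. Saying that a power series is a nice rational function means that it is the power series expansion of such a function. *)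

theory Defs
  imports "HOL-Analysis.Finite_Cartesian_Product" "HOL-Library.Poly_Mapping"
begin

text \<open>
  The variables \<open>t\<^sub>j\<close> are indexed by a finite type \<open>'k\<close>, so \<open>nat ^ 'k\<close> is the monoid of exponent
  vectors. A polynomial is an element of the monoid algebra of \<open>nat ^ 'k\<close>, with its library ring
  structure; a formal power series is an arbitrary family of coefficients.
\<close>

type_synonym ('a, 'k) mpolynomial = "(nat ^ 'k) \<Rightarrow>\<^sub>0 'a"
type_synonym ('a, 'k) mseries = "nat ^ 'k \<Rightarrow> 'a"

definition series_mult ::
  "('a::comm_ring_1, 'k::finite) mseries \<Rightarrow> ('a, 'k) mseries \<Rightarrow> ('a, 'k) mseries" where
  "series_mult f g = (\<lambda>n. \<Sum>(p, q) \<in> {(p, q). p + q = n}. f p * g q)"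

definition char_series :: "(nat ^ 'k::finite) set \<Rightarrow> ('a::comm_ring_1, 'k) mseries" where
  "char_series P = (\<lambda>p. if p \<in> P then 1 else 0)"

definition monomial :: "nat ^ 'k::finite \<Rightarrow> ('a::comm_ring_1, 'k) mpolynomial" where
  "monomial \<alpha> = Poly_Mapping.single \<alpha> 1"

definition nice_denominator :: "('a::comm_ring_1, 'k::finite) mpolynomial \<Rightarrow> bool" where
  "nice_denominator q \<longleftrightarrow> (\<exists>\<alpha>s. (\<forall>\<alpha>\<in>set \<alpha>s. \<alpha> \<noteq> 0) \<and> q = (\<Prod>\<alpha>\<leftarrow>\<alpha>s. 1 - monomial \<alpha>))"

text \<open>
  \<open>f\<close> is the expansion of \<open>p / q\<close> if \<open>f \<cdot> q = p\<close> as power series. If \<open>q\<close> has constant term 1, as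
  every nice denominator has, there is exactly one such \<open>f\<close> (\<open>ex1_is_expansion\<close> below).
\<close>

definition is_expansion ::
  "('a::comm_ring_1, 'k::finite) mseries \<Rightarrow> ('a, 'k) mpolynomial \<Rightarrow> ('a, 'k) mpolynomial \<Rightarrow> bool"
  where
  "is_expansion f p q \<longleftrightarrow>
     series_mult f (Poly_Mapping.lookup q) = Poly_Mapping.lookup p"

definition nice_rational :: "('a::comm_ring_1, 'k::finite) mseries \<Rightarrow> bool" where
  "nice_rational f \<longleftrightarrow> (\<exists>p q. nice_denominator q \<and> is_expansion f p q)"

lemma finite_splits: "finite {(p, q). p + q = (n :: nat ^ 'k::finite)}"
proof -
  have fin: "finite {p :: nat ^ 'k. \<forall>j. p $ j \<le> n $ j}"
  proof (rule finite_imageD)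
    show "finite (vec_nth ` {p :: nat ^ 'k. \<forall>j. p $ j \<le> n $ j})"
      by (rule finite_subset[OF _ finite_PiE[of UNIV "\<lambda>j. {..n $ j}"]]) (auto simp: PiE_def)
    show "inj_on vec_nth {p :: nat ^ 'k. \<forall>j. p $ j \<le> n $ j}"
      by (auto simp: inj_on_def vec_nth_inject)
  qed
  have "{(p, q). p + q = n} \<subseteq> {p. \<forall>j. p $ j \<le> n $ j} \<times> {q. \<forall>j. q $ j \<le> n $ j}"
    by auto
  then show ?thesis
    by (rule finite_subset) (intro finite_cartesian_product fin)
qed

lemma series_mult_lookup:
  fixes p q :: "('a::comm_ring_1, 'k::finite) mpolynomial"
  shows "series_mult (Poly_Mapping.lookup p) (Poly_Mapping.lookup q) = Poly_Mapping.lookup (p * q)"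
proof
  fix n :: "nat ^ 'k"
  let ?S = "{(u, v). u + v = n}"
  let ?h = "\<lambda>(u, v). Poly_Mapping.lookup p u * Poly_Mapping.lookup q v"
  have "Poly_Mapping.lookup (p * q) n =
      (\<Sum>(u, v). Poly_Mapping.lookup p u * Poly_Mapping.lookup q v when n = u + v)"
    by (simp add: times_poly_mapping.rep_eq prod_fun_unfold_prod)
  also have "\<dots> = Sum_any (\<lambda>x. ?h x when x \<in> ?S)"
    by (rule Sum_any.cong) (auto simp: when_def)
  also have "\<dots> = (\<Sum>x\<in>?S. ?h x when x \<in> ?S)"
    by (rule Sum_any.expand_superset) (auto simp: finite_splits when_def)
  also have "\<dots> = series_mult (Poly_Mapping.lookup p) (Poly_Mapping.lookup q) n"
    unfolding series_mult_def by (rule sum.cong) (auto simp: when_def)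
  finally show "series_mult (Poly_Mapping.lookup p) (Poly_Mapping.lookup q) n
      = Poly_Mapping.lookup (p * q) n" ..
qed

lemma series_mult_0:
  "series_mult f g 0 = f 0 * g (0 :: nat ^ 'k::finite)"
proof -
  have "{(p, q). p + q = (0 :: nat ^ 'k)} = {(0, 0)}"
    by (auto simp: vec_eq_iff)
  then show ?thesis by (simp add: series_mult_def)
qed

lemma nice_denominator_constant_term:
  fixes q :: "('a::comm_ring_1, 'k::finite) mpolynomial"
  assumes "nice_denominator q"
  shows "Poly_Mapping.lookup q 0 = 1"
proof -
  have "Poly_Mapping.lookup (\<Prod>\<alpha>\<leftarrow>\<alpha>s. 1 - monomial \<alpha> :: ('a, 'k) mpolynomial) 0 = 1"
    if "\<forall>\<alpha>\<in>set \<alpha>s. \<alpha> \<noteq> 0" for \<alpha>s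
    using that
  proof (induction \<alpha>s)
    case Nil
    then show ?case by simp
  next
    case (Cons \<alpha> \<alpha>s)
    have "Poly_Mapping.lookup (1 - monomial \<alpha> :: ('a, 'k) mpolynomial) 0 = 1"
      using Cons.prems by (simp add: monomial_def lookup_minus lookup_single when_def)
    with Cons show ?case
      by (simp add: fun_cong[OF series_mult_lookup, symmetric] series_mult_0)
  qed
  then show ?thesis
    using assms by (auto simp: nice_denominator_def)
qed

lemma ex1_is_expansion:
  fixes p q :: "('a::comm_ring_1, 'k::finite) mpolynomial"
  assumes q0: "Poly_Mapping.lookup q 0 = 1"
  shows "\<exists>!f. is_expansion f p q"
proof -
  define S where "S n = {(u, v). u + v = n} - {(n, 0)}" for n :: "nat ^ 'k"
  define d where "d n = (\<Sum>j\<in>UNIV. n $ j)" for n :: "nat ^ 'k"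
  define F where "F f n = Poly_Mapping.lookup p n - (\<Sum>(u, v)\<in>S n. f u * Poly_Mapping.lookup q v)"
    for f n
  have less: "d u < d n" if "(u, v) \<in> S n" for u v n
  proof -
    have n: "n = u + v" and "v \<noteq> 0"
      using that by (auto simp: S_def)
    from \<open>v \<noteq> 0\<close> obtain j where "v $ j \<noteq> 0"
      by (auto simp: vec_eq_iff)
    then have "d v > 0"
      unfolding d_def by (meson UNIV_I finite gr_zeroI sum_eq_0_iff)
    moreover have "d n = d u + d v"
      by (simp add: n d_def sum.distrib)
    ultimately show ?thesis by simp
  qed
  have split: "series_mult f (Poly_Mapping.lookup q) n =
      f n + (\<Sum>(u, v)\<in>S n. f u * Poly_Mapping.lookup q v)" for f n
    unfolding series_mult_def S_def
    by (subst sum.remove[OF finite_splits, of "(n, 0)"]) (simp_all add: q0)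
  have iff: "is_expansion f p q \<longleftrightarrow> (\<forall>n. f n = F f n)" for f
    unfolding is_expansion_def F_def fun_eq_iff split eq_diff_eq ..
  have F_cong: "F f n = F g n" if "\<And>u. d u < d n \<Longrightarrow> f u = g u" for f g n
  proof -
    have "(\<Sum>(u, v)\<in>S n. f u * Poly_Mapping.lookup q v) =
        (\<Sum>(u, v)\<in>S n. g u * Poly_Mapping.lookup q v)"
      by (rule sum.cong) (use that less in auto)
    then show ?thesis
      by (simp only: F_def)
  qed
  have adm: "adm_wf (measure d) F"
    unfolding adm_wf_def by (intro allI impI F_cong) simp
  have "is_expansion (wfrec (measure d) F) p q"
    unfolding iff by (intro allI fun_cong[OF wfrec_fixpoint[OF wf_measure adm]])
  moreover have "f = g" if "is_expansion f p q" "is_expansion g p q" for f g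
  proof
    fix n show "f n = g n"
    proof (induction n rule: measure_induct_rule[of d])
      case (less n)
      have "f n = F f n" "g n = F g n"
        using that by (simp_all only: iff)
      moreover have "F f n = F g n"
        using less by (rule F_cong)
      ultimately show ?case by simp
    qed
  qed
  ultimately show ?thesis by blast
qed

end

theory Submission
  imports Defs "HOL-Library.Multiset"
begin

text \<open>
  Consider the series \<open>t^v / \<Prod>g\<in>M. (1 - t^g)\<close> and restrict its support to a half-space
  \<open>l x + c \<ge> 0\<close>. The result is a finite sum of series of the same shape, by a variant of Elliott's
  algorithm. If \<open>g, h \<in> M\<close> satisfy \<open>l g = p > 0 > -q = l h\<close>, sorting exponents by residues
  replaces \<open>g\<close> and \<open>h\<close> by \<open>q g\<close> and \<open>p h\<close>, whose weights are opposite; comparing the exponents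
  of these two then replaces one of them by \<open>q g + p h\<close>, of weight zero. So the number of
  generators of nonzero weight drops, until all weights have the same sign; then the
  half-space contains either all but finitely many or only finitely many multiples of a generator of
  nonzero weight, and these finitely many are peeled off one by one. Starting from \<open>\<Prod>j. 1 / (1 - t_j)\<close>, the inequalities are imposed one at a time.
\<close>

section \<open>Total degree and multiples of exponent vectors\<close>

definition degree :: "nat ^ 'k::finite \<Rightarrow> nat" where
  "degree x = (\<Sum>j\<in>UNIV. x $ j)"

lemma degree_add: "degree (x + y) = degree x + degree y"
  by (simp add: degree_def sum.distrib)

lemma degree_scale: "degree (n *s x) = n * degree x"
  by (simp add: degree_def sum_distrib_left)

lemma degree_pos: "x \<noteq> 0 \<Longrightarrow> degree x > 0"
  by (auto simp: degree_def vec_eq_iff intro: gr0I)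

lemma le_degree_add_scale:
  assumes "g \<noteq> 0"
  shows "n \<le> degree (v + n *s g)"
  using mult_le_mono2[of 1 "degree g" n] degree_pos[OF assms]
  by (simp add: degree_add degree_scale trans_le_add2)

lemma scale_simps:
  fixes g :: "nat ^ 'k::finite"
  shows "0 *s g = 0" "Suc n *s g = g + n *s g"
  by (simp_all add: vec_eq_iff)

lemma scale_nonzero: "n > 0 \<Longrightarrow> (g :: nat ^ 'k::finite) \<noteq> 0 \<Longrightarrow> n *s g \<noteq> 0"
  by (simp add: vec_eq_iff)

lemma additive_zero:
  fixes l :: "nat ^ 'k::finite \<Rightarrow> int"
  assumes "\<And>x y. l (x + y) = l x + l y"
  shows "l 0 = 0"
  using assms[of 0 0] by simp

lemma additive_scale:
  fixes l :: "nat ^ 'k::finite \<Rightarrow> int"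
  assumes "\<And>x y. l (x + y) = l x + l y"
  shows "l (n *s x) = int n * l x"
  by (induction n) (simp_all add: scale_simps assms additive_zero algebra_simps)

section \<open>Cone series: support and recurrence\<close>

text \<open>
  Multiplication by \<open>1 / (1 - t^g)\<close>, for a family \<open>F\<close> in which \<open>F v\<close> is a fixed series times \<open>t^v\<close>.
  For \<open>g \<noteq> 0\<close> the terms with \<open>n > degree x\<close> do not contribute to the coefficient at \<open>x\<close>; the
  bound makes the sum finite also for \<open>g = 0\<close>, so that these operators commute without exception
  and can be folded over a multiset.
\<close>

definition geometric :: "nat ^ 'k::finite \<Rightarrow> (nat ^ 'k \<Rightarrow> ('a::comm_ring_1, 'k) mseries) \<Rightarrow>
    nat ^ 'k \<Rightarrow> ('a, 'k) mseries" where
  "geometric g F = (\<lambda>v x. \<Sum>n\<le>degree x. F (v + n *s g) x)"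

definition cone_series :: "(nat ^ 'k::finite) multiset \<Rightarrow> nat ^ 'k \<Rightarrow> ('a::comm_ring_1, 'k) mseries" where
  "cone_series M = fold_mset geometric (\<lambda>v x. if x = v then 1 else 0) M"

lemma comp_fun_commute_geometric:
  "comp_fun_commute (geometric :: nat ^ 'k::finite \<Rightarrow> (nat ^ 'k \<Rightarrow> ('a::comm_ring_1, 'k) mseries) \<Rightarrow> _)"
proof
  fix g h :: "nat ^ 'k"
  show "geometric g \<circ> geometric h = (geometric h \<circ> geometric g :: (nat ^ 'k \<Rightarrow> ('a, 'k) mseries) \<Rightarrow> _)"
  proof (intro ext)
    fix F :: "nat ^ 'k \<Rightarrow> ('a, 'k) mseries" and v x
    have "(\<Sum>n\<le>degree x. \<Sum>m\<le>degree x. F (v + n *s g + m *s h) x) =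
      (\<Sum>m\<le>degree x. \<Sum>n\<le>degree x. F (v + m *s h + n *s g) x)"
      by (subst sum.swap) (simp add: ac_simps)
    then show "(geometric g \<circ> geometric h) F v x = (geometric h \<circ> geometric g) F v x"
      by (simp add: geometric_def)
  qed
qed

lemma cone_series_empty: "cone_series {#} v x = (if x = v then 1 else 0)"
  by (simp add: cone_series_def)

lemma cone_series_add_mset:
  "cone_series (add_mset g M) v x = (\<Sum>n\<le>degree x. cone_series M (v + n *s g) x)"
  unfolding cone_series_def comp_fun_commute.fold_mset_add_mset[OF comp_fun_commute_geometric]
  by (simp add: geometric_def)

text \<open>The support lies in \<open>v\<close> plus the monoid generated by \<open>M\<close>.
  Phrased through an invariant \<open>P\<close>, this serves degree bounds, divisibility by a
  monomial and signs of a linear form alike.\<close>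

lemma cone_series_support:
  assumes "cone_series M v x \<noteq> (0 :: 'a::comm_ring_1)" "P v" "\<And>g y. g \<in># M \<Longrightarrow> P y \<Longrightarrow> P (y + g)"
  shows "P x"
  using assms
proof (induction M arbitrary: v)
  case empty
  then show ?case by (auto simp: cone_series_empty split: if_splits)
next
  case (add g M)
  from add.prems(1) obtain n where n: "cone_series M (v + n *s g) x \<noteq> (0 :: 'a)"
    unfolding cone_series_add_mset by (rule sum.not_neutral_contains_not_neutral)
  have "P (v + n *s g)"
  proof (induction n)
    case 0
    then show ?case using add.prems by (simp add: scale_simps)
  next
    case (Suc n)
    from add.prems(3)[OF _ this, of g] show ?case by (simp add: scale_simps ac_simps)
  qed
  with n add show ?case by auto
qed

lemma cone_series_eq_0:
  assumes "degree x < degree v"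
  shows "cone_series M v x = 0"
  using cone_series_support[of M v x "\<lambda>y. degree v \<le> degree y"] assms
  by (force simp: degree_add)

text \<open>The term \<open>n = degree x + 1\<close> starts in degree above that of \<open>x\<close>
  and vanishes there, so it may be appended to the truncated sum; shifting the index then splits off
  \<open>n = 0\<close>. This is multiplication by 1 - t^g, free of the truncation bound.\<close>

lemma cone_series_rec:
  assumes "g \<noteq> 0"
  shows "cone_series (add_mset g M) v x =
    (cone_series M v x + cone_series (add_mset g M) (v + g) x :: 'a::comm_ring_1)"
proof -
  let ?F = "\<lambda>n. cone_series M (v + n *s g) x :: 'a"
  have "degree x < degree (v + Suc (degree x) *s g)"
    using le_degree_add_scale[OF assms] by (rule Suc_le_lessD)
  then have "cone_series (add_mset g M) v x = (\<Sum>n\<le>Suc (degree x). ?F n)"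
    by (simp add: cone_series_add_mset cone_series_eq_0)
  also have "\<dots> = ?F 0 + (\<Sum>n\<le>degree x. ?F (Suc n))"
    by (rule sum.atMost_Suc_shift)
  finally show ?thesis
    by (simp add: cone_series_add_mset scale_simps add.assoc)
qed

section \<open>Identities between cone series\<close>

text \<open>The difference of \<open>F\<close> and \<open>G\<close> does not change under
  \<open>v\<close> -> \<open>v + g\<close>, and repeated shifts push the degree beyond
  \<open>N\<close>, where it is zero. Thus an identity may be checked after multiplication by 1 -
  t^g.\<close>

lemma recurrence_unique:
  fixes F G :: "nat ^ 'k::finite \<Rightarrow> ('a::comm_ring_1, 'k) mseries"
  assumes "g \<noteq> 0"
    and "\<And>v. F v x - F (v + g) x = G v x - G (v + g) x"
    and "\<And>v. degree v > N \<Longrightarrow> F v x = G v x"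
  shows "F v x = G v x"
proof -
  have "F v x - G v x = F (v + n *s g) x - G (v + n *s g) x" for n
  proof (induction n)
    case (Suc n)
    let ?w = "v + n *s g"
    have "F ?w x - G ?w x = F (?w + g) x - G (?w + g) x"
      using assms(2)[of ?w] by (simp add: algebra_simps)
    moreover have "v + Suc n *s g = ?w + g"
      by (simp add: scale_simps ac_simps)
    ultimately show ?case
      using Suc.IH by simp
  qed (simp add: scale_simps)
  moreover have "degree (v + Suc N *s g) > N"
    using le_degree_add_scale[OF assms(1)] by (rule Suc_le_lessD)
  ultimately show ?thesis
    using assms(3) by (metis eq_iff_diff_eq_0)
qed

text \<open>Writing \<open>A\<close>, \<open>B\<close> for the monomials of \<open>g\<close>, \<open>h\<close>, this is
  \<open>1 / ((1 - A) (1 - B)) = 1 / ((1 - A) (1 - A B)) + B / ((1 - B) (1 - A B))\<close>.\<close>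

lemma cone_series_elliott:
  fixes g h :: "nat ^ 'k::finite"
  assumes g: "g \<noteq> 0" and h: "h \<noteq> 0"
  shows "cone_series (add_mset g (add_mset h M)) v x =
    (cone_series (add_mset g (add_mset (g + h) M)) v x +
     cone_series (add_mset h (add_mset (g + h) M)) (v + h) x :: 'a::comm_ring_1)"
proof -
  define k where "k = g + h"
  have k: "k \<noteq> 0" using g by (auto simp: k_def vec_eq_iff)
  let ?C = "\<lambda>M v. cone_series M v x :: 'a"
  \<comment> \<open>As (1 - B) + B - A B = 1 - A B, this is the factor 1 / (1 - B) written over (1 -
    B) (1 - A B).\<close>
  define D where "D v (x :: nat ^ 'k) = (cone_series (add_mset k M) v x +
    cone_series (add_mset h (add_mset k M)) (v + h) x -
    cone_series (add_mset h (add_mset k M)) (v + k) x :: 'a)" for v x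
  have D: "D v x = ?C (add_mset h M) v" for v
  proof (rule recurrence_unique[where F = D and g = h and N = "degree x"])
    fix v
    have "?C (add_mset h (add_mset k M)) (v + h) =
        ?C (add_mset k M) (v + h) + ?C (add_mset h (add_mset k M)) (v + h + h)"
      "?C (add_mset h (add_mset k M)) (v + k) =
        ?C (add_mset k M) (v + k) + ?C (add_mset h (add_mset k M)) (v + k + h)"
      "?C (add_mset k M) v = ?C M v + ?C (add_mset k M) (v + k)"
      "?C (add_mset h M) v = ?C M v + ?C (add_mset h M) (v + h)"
      by (rule cone_series_rec h k)+
    then show "D v x - D (v + h) x = ?C (add_mset h M) v - ?C (add_mset h M) (v + h)"
      by (simp add: D_def ac_simps)
  qed (auto simp: h D_def cone_series_eq_0 degree_add)
  \<comment> \<open>\<open>R\<close> is the claimed right-hand side; multiplying it by 1 - A yields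
    \<open>D\<close>.\<close>
  define R where "R v (x :: nat ^ 'k) = (cone_series (add_mset g (add_mset k M)) v x +
    cone_series (add_mset h (add_mset k M)) (v + h) x :: 'a)" for v x
  have "R v x = ?C (add_mset g (add_mset h M)) v"
  proof (rule recurrence_unique[where F = R and g = g and N = "degree x"])
    fix v
    have "?C (add_mset g (add_mset k M)) v =
        ?C (add_mset k M) v + ?C (add_mset g (add_mset k M)) (v + g)"
      "?C (add_mset g (add_mset h M)) v =
        ?C (add_mset h M) v + ?C (add_mset g (add_mset h M)) (v + g)"
      by (rule cone_series_rec g)+
    moreover have "v + k = v + g + h" by (simp add: k_def ac_simps)
    ultimately show "R v x - R (v + g) x =
        ?C (add_mset g (add_mset h M)) v - ?C (add_mset g (add_mset h M)) (v + g)"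
      using D[of v] by (simp add: R_def D_def algebra_simps)
  qed (auto simp: g R_def cone_series_eq_0 degree_add)
  then show ?thesis by (simp add: R_def k_def)
qed

text \<open>This is 1 / (1 - A) = (1 + A + ... + A^(q-1)) / (1 - A^q), with \<open>r\<close> the
  residue modulo \<open>q\<close> of the exponent of A.\<close>

lemma cone_series_scale:
  assumes g: "g \<noteq> 0" and q: "q > 0"
  shows "cone_series (add_mset g M) v x =
    (\<Sum>r<q. cone_series (add_mset (q *s g) M) (v + r *s g) x :: 'a::comm_ring_1)"
proof -
  define R where
    "R v x = (\<Sum>r<q. cone_series (add_mset (q *s g) M) (v + r *s g) x :: 'a)" for v x
  have "R v x = cone_series (add_mset g M) v x"
  proof (rule recurrence_unique[where F = R and g = g and N = "degree x"])
    fix v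
    let ?G = "\<lambda>r. cone_series (add_mset (q *s g) M) (v + r *s g) x :: 'a"
    \<comment> \<open>The shift by \<open>g\<close> raises \<open>r\<close> by one, so the
      difference telescopes to the terms \<open>r = 0\<close> and \<open>r = q\<close>, which are
      one step of \<open>q *s g\<close> apart.\<close>
    have "R (v + g) x = (\<Sum>r<q. ?G (Suc r))"
      by (simp add: R_def scale_simps ac_simps)
    moreover have "(\<Sum>r<q. ?G r) + ?G q = ?G 0 + (\<Sum>r<q. ?G (Suc r))"
      using sum.lessThan_Suc_shift[of ?G q] by simp
    ultimately have "R v x - R (v + g) x = ?G 0 - ?G q"
      by (simp add: R_def algebra_simps)
    also have "\<dots> = cone_series M v x"
      using cone_series_rec[OF scale_nonzero[OF q g], of M v x, where ?'a = 'a]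
      by (simp add: scale_simps)
    finally show "R v x - R (v + g) x =
        cone_series (add_mset g M) v x - cone_series (add_mset g M) (v + g) x"
      using cone_series_rec[OF g, of M v x, where ?'a = 'a] by simp
  qed (auto simp: g R_def cone_series_eq_0 degree_add)
  then show ?thesis by (simp add: R_def)
qed

text \<open>The truncation bound changes from \<open>degree x\<close> to
  \<open>degree (x + d)\<close>, so the defining sums do not match term by term; both sides satisfy
  the same recurrence instead.\<close>

lemma cone_series_translate:
  assumes "0 \<notin># M"
  shows "cone_series M (v + d) (x + d) = (cone_series M v x :: 'a::comm_ring_1)"
  using assms
proof (induction M arbitrary: v)
  case empty
  then show ?case by (simp add: cone_series_empty)
next
  case (add g M)
  then have g: "g \<noteq> 0" and IH: "cone_series M (v + d) (x + d) = (cone_series M v x :: 'a)" for v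
    by auto
  show ?case
  proof (rule recurrence_unique[where g = g and N = "degree x" and x = x
        and F = "\<lambda>v x. cone_series (add_mset g M) (v + d) (x + d)"])
    fix v
    show "cone_series (add_mset g M) (v + d) (x + d) - cone_series (add_mset g M) (v + g + d) (x + d)
      = (cone_series (add_mset g M) v x - cone_series (add_mset g M) (v + g) x :: 'a)"
      using cone_series_rec[OF g, of M v x, where ?'a = 'a]
        cone_series_rec[OF g, of M "v + d" "x + d", where ?'a = 'a] IH[of v]
      by (simp add: ac_simps)
  qed (auto simp: g cone_series_eq_0 degree_add)
qed

section \<open>Products of power series and closure of nice rational functions\<close>

lemma series_mult_assoc:
  fixes f g h :: "('a::comm_ring_1, 'k::finite) mseries"
  shows "series_mult (series_mult f g) h = series_mult f (series_mult g h)"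
proof
  fix n :: "nat ^ 'k"
  let ?S = "\<lambda>n :: nat ^ 'k. {(p, q). p + q = n}"
  have "series_mult (series_mult f g) h n =
      (\<Sum>z\<in>?S n. \<Sum>w\<in>?S (fst z). f (fst w) * g (snd w) * h (snd z))"
    by (simp add: series_mult_def case_prod_unfold sum_distrib_right)
  also have "\<dots> = (\<Sum>(z, w)\<in>Sigma (?S n) (\<lambda>z. ?S (fst z)). f (fst w) * g (snd w) * h (snd z))"
    by (rule sum.Sigma) (auto simp: finite_splits)
  also have "\<dots> = (\<Sum>(z, w)\<in>Sigma (?S n) (\<lambda>z. ?S (snd z)). f (fst z) * (g (fst w) * h (snd w)))"
    by (rule sum.reindex_bij_witness[where
          i = "\<lambda>(z, w). ((fst z + fst w, snd w), (fst z, fst w))" and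
          j = "\<lambda>(z, w). ((fst w, snd w + snd z), (snd w, snd z))"])
      (auto simp: ac_simps)
  also have "\<dots> = (\<Sum>z\<in>?S n. \<Sum>w\<in>?S (snd z). f (fst z) * (g (fst w) * h (snd w)))"
    by (rule sum.Sigma[symmetric]) (auto simp: finite_splits)
  also have "\<dots> = series_mult f (series_mult g h) n"
    by (simp add: series_mult_def case_prod_unfold sum_distrib_left)
  finally show "series_mult (series_mult f g) h n = series_mult f (series_mult g h) n" .
qed

lemma series_mult_add_left:
  "series_mult (\<lambda>x. f x + g x) h = (\<lambda>x. series_mult f h x + series_mult g h x)"
  by (simp add: series_mult_def case_prod_unfold distrib_right sum.distrib)

lemma series_mult_monomial_add:
  "series_mult f (Poly_Mapping.lookup (monomial d)) (x + d) = f x"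
proof -
  have "series_mult f (Poly_Mapping.lookup (monomial d)) (x + d) =
      (\<Sum>(p, q)\<in>{(x, d)}. f p * Poly_Mapping.lookup (monomial d) q)"
    unfolding series_mult_def
    by (rule sum.mono_neutral_right)
      (auto simp: finite_splits monomial_def lookup_single when_def split: if_splits)
  then show ?thesis by (simp add: monomial_def)
qed

lemma series_mult_monomial_eq_0:
  assumes "\<nexists>y. x = y + d"
  shows "series_mult f (Poly_Mapping.lookup (monomial d)) x = 0"
  unfolding series_mult_def
  by (rule sum.neutral) (use assms in \<open>auto simp: monomial_def lookup_single when_def\<close>)

lemma nice_rational_add:
  fixes f g :: "('a::comm_ring_1, 'k::finite) mseries"
  assumes "nice_rational f" "nice_rational g"
  shows "nice_rational (\<lambda>x. f x + g x)"
proof -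
  from assms obtain p q p' q' where
    q: "nice_denominator q" "nice_denominator q'" and
    p: "series_mult f (Poly_Mapping.lookup q) = Poly_Mapping.lookup p"
      "series_mult g (Poly_Mapping.lookup q') = Poly_Mapping.lookup p'"
    unfolding nice_rational_def is_expansion_def by blast
  have "nice_denominator (q * q')"
  proof -
    from q obtain as bs where "\<forall>\<alpha>\<in>set (as @ bs). \<alpha> \<noteq> 0"
      "q = (\<Prod>\<alpha>\<leftarrow>as. 1 - monomial \<alpha>)" "q' = (\<Prod>\<alpha>\<leftarrow>bs. 1 - monomial \<alpha>)"
      unfolding nice_denominator_def by (metis Un_iff set_append)
    then show ?thesis
      unfolding nice_denominator_def by (intro exI[of _ "as @ bs"]) simp
  qed
  moreover have "series_mult f (Poly_Mapping.lookup (q * q')) = Poly_Mapping.lookup (p * q')"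
    by (simp add: p flip: series_mult_lookup series_mult_assoc)
  moreover have "series_mult g (Poly_Mapping.lookup (q * q')) = Poly_Mapping.lookup (p' * q)"
    unfolding mult.commute[of q q'] by (simp add: p flip: series_mult_lookup series_mult_assoc)
  ultimately show ?thesis
    unfolding nice_rational_def is_expansion_def
    by (intro exI[of _ "p * q' + p' * q"] exI[of _ "q * q'"])
      (simp add: series_mult_add_left fun_eq_iff lookup_add)
qed

lemma nice_rational_polynomial:
  "nice_rational (Poly_Mapping.lookup (p :: ('a::comm_ring_1, 'k::finite) mpolynomial))"
  unfolding nice_rational_def is_expansion_def nice_denominator_def
  by (intro exI[of _ p] exI[of _ 1] conjI exI[of _ "[]"]) (simp_all add: series_mult_lookup)

lemma nice_rational_divide:
  fixes f :: "('a::comm_ring_1, 'k::finite) mseries"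
  assumes d: "d \<noteq> 0" and "nice_rational (series_mult f (Poly_Mapping.lookup (1 - monomial d)))"
  shows "nice_rational f"
proof -
  from assms obtain p q where q: "nice_denominator q" and
    p: "series_mult f (Poly_Mapping.lookup ((1 - monomial d) * q)) = Poly_Mapping.lookup p"
    unfolding nice_rational_def is_expansion_def by (auto simp: series_mult_assoc series_mult_lookup)
  from q obtain as where "\<forall>\<alpha>\<in>set as. \<alpha> \<noteq> 0" "q = (\<Prod>\<alpha>\<leftarrow>as. 1 - monomial \<alpha>)"
    unfolding nice_denominator_def by blast
  with d have "nice_denominator ((1 - monomial d) * q)"
    unfolding nice_denominator_def by (intro exI[of _ "d # as"]) simp
  with p show ?thesis
    unfolding nice_rational_def is_expansion_def by blast
qed

text \<open>Identifies moving the base point with multiplication by t^d, which turns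
  \<open>cone_series_rec\<close> into an identity of power series. At an \<open>x\<close> not
  divisible by t^d both sides vanish.\<close>

lemma cone_series_mult_monomial:
  assumes "0 \<notin># M"
  shows "series_mult (cone_series M v) (Poly_Mapping.lookup (monomial d)) x =
    (cone_series M (v + d) x :: 'a::comm_ring_1)"
proof (cases "\<exists>y. x = y + d")
  case True
  then show ?thesis
    using assms by (auto simp: series_mult_monomial_add cone_series_translate)
next
  case False
  have "\<exists>y. x = y + d" if "cone_series M (v + d) x \<noteq> (0 :: 'a)"
    using that by (rule cone_series_support) (auto simp: ac_simps, metis add.assoc add.commute)
  with False show ?thesis by (auto simp: series_mult_monomial_eq_0)
qed

lemma nice_rational_cone_series:
  assumes "0 \<notin># M"
  shows "nice_rational (cone_series M v :: ('a::comm_ring_1, 'k::finite) mseries)"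
  using assms
proof (induction M)
  case empty
  have "cone_series {#} v = (Poly_Mapping.lookup (monomial v) :: ('a, 'k) mseries)"
    by (auto simp: fun_eq_iff cone_series_empty monomial_def lookup_single when_def)
  then show ?case by (simp add: nice_rational_polynomial)
next
  case (add g M)
  let ?f = "cone_series (add_mset g M) v :: ('a, 'k) mseries"
  from add.prems have g: "g \<noteq> 0" by auto
  have one: "series_mult ?f (Poly_Mapping.lookup 1) = ?f"
    using series_mult_monomial_add[of ?f 0] by (simp add: fun_eq_iff monomial_def flip: single_one)
  have "series_mult ?f (Poly_Mapping.lookup (1 - monomial g)) x = cone_series M v x" for x
  proof -
    have "series_mult ?f (Poly_Mapping.lookup (1 - monomial g)) x =
      series_mult ?f (Poly_Mapping.lookup 1) x - series_mult ?f (Poly_Mapping.lookup (monomial g)) x"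
      by (simp add: series_mult_def lookup_minus case_prod_unfold right_diff_distrib sum_subtractf)
    also have "\<dots> = cone_series M v x"
      using cone_series_rec[OF g, of M v x, where ?'a = 'a]
      by (simp add: one cone_series_mult_monomial[OF add.prems])
    finally show ?thesis .
  qed
  then have "series_mult ?f (Poly_Mapping.lookup (1 - monomial g)) = cone_series M v" ..
  moreover have "nice_rational (cone_series M v :: ('a, 'k) mseries)"
    using add by simp
  ultimately show ?case
    by (intro nice_rational_divide[OF g, of ?f]) simp
qed

section \<open>Finite sums of cone series and their restriction to a half-space\<close>

text \<open>Scalars are absent because every decomposition below has all coefficients 1.\<close>

inductive cone_sum :: "('a::comm_ring_1, 'k::finite) mseries \<Rightarrow> bool" where
  zero: "cone_sum (\<lambda>x. 0)"
| cone: "0 \<notin># M \<Longrightarrow> cone_sum (cone_series M v)"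
| add: "cone_sum f \<Longrightarrow> cone_sum g \<Longrightarrow> cone_sum (\<lambda>x. f x + g x)"

lemma cone_sum_sum:
  "(\<And>i. i \<in> A \<Longrightarrow> cone_sum (f i)) \<Longrightarrow> cone_sum (\<lambda>x. \<Sum>i\<in>A. f i x)"
  by (induction A rule: infinite_finite_induct) (auto intro: cone_sum.intros)

lemma nice_rational_cone_sum: "cone_sum f \<Longrightarrow> nice_rational f"
proof (induction rule: cone_sum.induct)
  case zero
  show ?case using nice_rational_polynomial[of 0] by (simp add: zero_poly_mapping.rep_eq)
qed (simp_all add: nice_rational_cone_series nice_rational_add)

definition restrict_series ::
  "(nat ^ 'k::finite) set \<Rightarrow> ('a::comm_ring_1, 'k) mseries \<Rightarrow> ('a, 'k) mseries" where
  "restrict_series H f = (\<lambda>x. if x \<in> H then f x else 0)"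

lemma restrict_series_add:
  "restrict_series H (\<lambda>x. f x + g x) = (\<lambda>x. restrict_series H f x + restrict_series H g x)"
  by (auto simp: restrict_series_def)

lemma restrict_series_sum:
  "restrict_series H (\<lambda>x. \<Sum>i\<in>A. f i x) = (\<lambda>x. \<Sum>i\<in>A. restrict_series H (f i) x)"
  by (auto simp: restrict_series_def)

lemma cone_sum_restrict_cone:
  fixes l :: "nat ^ 'k::finite \<Rightarrow> int"
  assumes l: "\<And>x y. l (x + y) = l x + l y"
    and "0 \<notin># M"
  shows "cone_sum (restrict_series {x. l x + c \<ge> 0} (cone_series M v) :: ('a::comm_ring_1, 'k) mseries)"
  using assms(2)
\<comment> \<open>Induction on the number of generators of nonzero weight, for all base points at
  once.\<close>
proof (induction "size {#g \<in># M. l g \<noteq> 0#}" arbitrary: M v rule: less_induct)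
  case less
  let ?res = "restrict_series {x. l x + c \<ge> 0} :: ('a, 'k) mseries \<Rightarrow> _"
  let ?C = "\<lambda>M v. cone_series M v :: ('a, 'k) mseries"
  consider (mixed) g h where "g \<in># M" "h \<in># M" "l g > 0" "l h < 0"
    | (nonneg) "\<forall>g\<in>#M. l g \<ge> 0" | (nonpos) "\<forall>g\<in>#M. l g \<le> 0"
    by (metis linorder_not_le)
  then show ?case
  proof cases
    case mixed
    from mixed obtain N where M: "M = add_mset g (add_mset h N)"
      by (metis insert_noteq_member less_asym multi_member_split)
    \<comment> \<open>The multiples \<open>q *s g\<close> and \<open>p *s h\<close> have weights p q
      and -p q, which cancel in their sum.\<close>
    define p q where "p = nat (l g)" and "q = nat (- l h)"
    have pq: "p > 0" "q > 0" using mixed by (auto simp: p_def q_def)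
    have gh: "g \<noteq> 0" "h \<noteq> 0" "0 \<notin># N" using less.prems M by auto
    let ?g = "q *s g" and ?h = "p *s h"
    have nz: "?g \<noteq> 0" "?h \<noteq> 0" "?g + ?h \<noteq> 0"
      using scale_nonzero pq gh by (auto simp: vec_eq_iff)
    have lg: "l (?g + ?h) = 0"
      using mixed by (simp add: l additive_scale[OF l] p_def q_def)
    have "?C M v = (\<lambda>x. \<Sum>r<q. \<Sum>s<p. ?C (add_mset ?g (add_mset ?h N)) (v + r *s g + s *s h) x)"
    proof
      fix x
      have "?C M v x = (\<Sum>r<q. ?C (add_mset h (add_mset ?g N)) (v + r *s g) x)"
        by (simp add: M cone_series_scale[OF gh(1) pq(2)] add_mset_commute)
      then show "?C M v x =
          (\<Sum>r<q. \<Sum>s<p. ?C (add_mset ?g (add_mset ?h N)) (v + r *s g + s *s h) x)"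
        by (simp add: cone_series_scale[OF gh(2) pq(1)] add_mset_commute)
    qed
    also have "\<dots> = (\<lambda>x. \<Sum>r<q. \<Sum>s<p.
        ?C (add_mset ?g (add_mset (?g + ?h) N)) (v + r *s g + s *s h) x +
        ?C (add_mset ?h (add_mset (?g + ?h) N)) (v + r *s g + s *s h + ?h) x)"
      by (simp add: cone_series_elliott[OF nz(1,2)])
    finally have C: "?C M v = \<dots>" .
    \<comment> \<open>Only one of the two multiples survives in each summand, next to a generator of
      weight zero, so the count drops by at least one.\<close>
    have "cone_sum (?res (?C (add_mset y (add_mset (?g + ?h) N)) w))" if "y = ?g \<or> y = ?h" for y w
    proof (rule less.hyps)
      show "size {#g \<in># add_mset y (add_mset (?g + ?h) N). l g \<noteq> 0#} < size {#g \<in># M. l g \<noteq> 0#}"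
        using mixed by (simp add: M lg)
      show "0 \<notin># add_mset y (add_mset (?g + ?h) N)"
        using that nz gh by auto
    qed
    then show ?thesis
      unfolding C restrict_series_sum restrict_series_add
      by (intro cone_sum_sum cone_sum.add) auto
  next
    case nonneg
    show ?thesis
    \<comment> \<open>The measure is how far \<open>v\<close> lies outside the half-space; a shift
      by a generator of positive weight lowers it. Once \<open>v\<close> is inside, the whole
      support is.\<close>
    proof (induction "nat (- (l v + c))" arbitrary: v rule: less_induct)
      case IH: less
      show ?case
      proof (cases "l v + c \<ge> 0")
        case True
        have "l x + c \<ge> 0" if "?C M v x \<noteq> 0" for x
          using that True by (rule cone_series_support) (use nonneg in \<open>force simp: l\<close>)
        then have "?res (?C M v) = ?C M v"
          by (auto simp: restrict_series_def fun_eq_iff)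
        then show ?thesis using less.prems by (auto intro: cone_sum.cone)
      next
        case neg: False
        show ?thesis
        proof (cases "\<exists>g\<in>#M. l g \<noteq> 0")
          case True
          then obtain g N where M: "M = add_mset g N" and g: "l g \<noteq> 0"
            by (metis multi_member_split)
          have lg: "l g \<ge> 0" and "g \<noteq> 0" "0 \<notin># N" using nonneg less.prems M by auto
          have "cone_sum (?res (?C N v))"
            by (rule less.hyps) (use g \<open>0 \<notin># N\<close> in \<open>auto simp: M\<close>)
          moreover have "cone_sum (?res (?C M (v + g)))"
            by (rule IH) (use neg g lg in \<open>simp add: l\<close>)
          moreover have "?C M v = (\<lambda>x. ?C N v x + ?C M (v + g) x)"
            unfolding M using cone_series_rec[OF \<open>g \<noteq> 0\<close>] by blast
          ultimately show ?thesis by (simp add: restrict_series_add cone_sum.add)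
        next
          case False
          \<comment> \<open>All weights are zero here, so \<open>l\<close> is constant on the
            support.\<close>
          have "l x + c < 0" if "?C M v x \<noteq> 0" for x
            using that neg[unfolded not_le] by (rule cone_series_support) (use False in \<open>simp add: l\<close>)
          then have "?res (?C M v) = (\<lambda>x. 0)"
            by (force simp: restrict_series_def)
          then show ?thesis by (simp add: cone_sum.zero)
        qed
      qed
    qed
  next
    case nonpos
    show ?thesis
    \<comment> \<open>The added 1 lets the measure still decrease in the step from the boundary
      \<open>l v + c = 0\<close> to the outside.\<close>
    proof (induction "nat (l v + c + 1)" arbitrary: v rule: less_induct)
      case IH: less
      show ?case
      proof (cases "l v + c \<ge> 0")
        case False
        then have neg: "l v + c < 0" by simp
        have "l x + c < 0" if "?C M v x \<noteq> 0" for x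
          using that neg by (rule cone_series_support) (use nonpos in \<open>force simp: l\<close>)
        then have "?res (?C M v) = (\<lambda>x. 0)"
          by (force simp: restrict_series_def)
        then show ?thesis by (simp add: cone_sum.zero)
      next
        case pos: True
        show ?thesis
        proof (cases "\<exists>g\<in>#M. l g \<noteq> 0")
          case True
          then obtain g N where M: "M = add_mset g N" and g: "l g \<noteq> 0"
            by (metis multi_member_split)
          have lg: "l g \<le> 0" and "g \<noteq> 0" "0 \<notin># N" using nonpos less.prems M by auto
          have "cone_sum (?res (?C N v))"
            by (rule less.hyps) (use g \<open>0 \<notin># N\<close> in \<open>auto simp: M\<close>)
          moreover have "cone_sum (?res (?C M (v + g)))"
            by (rule IH) (use pos g lg in \<open>simp add: l\<close>)
          moreover have "?C M v = (\<lambda>x. ?C N v x + ?C M (v + g) x)"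
            unfolding M using cone_series_rec[OF \<open>g \<noteq> 0\<close>] by blast
          ultimately show ?thesis by (simp add: restrict_series_add cone_sum.add)
        next
          case False
          have "l x + c \<ge> 0" if "?C M v x \<noteq> 0" for x
            using that pos by (rule cone_series_support) (use False in \<open>simp add: l\<close>)
          then have "?res (?C M v) = ?C M v"
            by (auto simp: restrict_series_def fun_eq_iff)
          then show ?thesis using less.prems by (auto intro: cone_sum.cone)
        qed
      qed
    qed
  qed
qed

lemma cone_sum_restrict:
  fixes l :: "nat ^ 'k::finite \<Rightarrow> int"
  assumes l: "\<And>x y. l (x + y) = l x + l y" and "cone_sum f"
  shows "cone_sum (restrict_series {x. l x + c \<ge> 0} f)"
  using assms(2)
proof (induction rule: cone_sum.induct)
  case zero
  then show ?case by (simp add: restrict_series_def cone_sum.zero)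
next
  case (cone M v)
  then show ?case by (intro cone_sum_restrict_cone l)
next
  case (add f g)
  then show ?case by (simp add: restrict_series_add cone_sum.add)
qed

section \<open>The full orthant and the system of inequalities\<close>

text \<open>Stated for a subset \<open>J\<close> of the variables to allow induction: coordinates in
  \<open>J\<close> may grow from \<open>v\<close>, the others stay fixed.\<close>

lemma cone_series_axes:
  fixes v x :: "nat ^ 'k::finite"
  assumes "finite J"
  shows "cone_series (image_mset (\<lambda>j. axis j 1) (mset_set J)) v x =
    (if (\<forall>j\<in>J. v $ j \<le> x $ j) \<and> (\<forall>j\<in>-J. v $ j = x $ j) then 1 else 0 :: 'a::comm_ring_1)"
  using assms
proof (induction J arbitrary: v)
  case empty
  then show ?case by (auto simp: cone_series_empty vec_eq_iff)
next
  case (insert i J)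
  let ?e = "axis i 1 :: nat ^ 'k"
  have e: "?e \<noteq> 0" "(v + ?e) $ j = v $ j + (if j = i then 1 else 0)" for v j
    by (auto simp: axis_def vec_eq_iff)
  define F where "F v x = (if (\<forall>j\<in>insert i J. v $ j \<le> x $ j) \<and> (\<forall>j\<in>-insert i J. v $ j = x $ j)
    then 1 else 0 :: 'a)" for v x :: "nat ^ 'k"
  have "F v x = cone_series (add_mset ?e (image_mset (\<lambda>j. axis j 1) (mset_set J))) v x"
  proof (rule recurrence_unique[where F = F and g = ?e and N = "degree x", OF e(1)])
    fix v
    \<comment> \<open>The conditions on coordinates other than \<open>i\<close> are unaffected by a
      shift along axis \<open>i\<close>, so the difference of \<open>F\<close> turns the inequality
      at \<open>i\<close> into an equality.\<close>
    let ?P = "\<lambda>v. (\<forall>j\<in>J. v $ j \<le> x $ j) \<and> (\<forall>j\<in>-insert i J. v $ j = x $ j)"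
    have P: "?P (v + ?e) = ?P v" using insert.hyps(2) by (auto simp: axis_def)
    have "F v x = (if ?P v \<and> v $ i \<le> x $ i then 1 else 0)" for v by (auto simp: F_def)
    then have "F v x - F (v + ?e) x = (if ?P v \<and> v $ i = x $ i then 1 else 0)"
      unfolding P using insert.hyps(2) by (auto simp: axis_def)
    also have "\<dots> = cone_series (image_mset (\<lambda>j. axis j 1) (mset_set J)) v x"
      using insert.hyps(2) unfolding insert.IH by (intro if_cong) auto
    finally show "F v x - F (v + ?e) x =
        cone_series (add_mset ?e (image_mset (\<lambda>j. axis j 1) (mset_set J))) v x -
        cone_series (add_mset ?e (image_mset (\<lambda>j. axis j 1) (mset_set J))) (v + ?e) x"
      using cone_series_rec[OF e(1), of _ v x, where ?'a = 'a] by simp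
  next
    fix v :: "nat ^ 'k" assume deg: "degree v > degree x"
    have "\<not> (\<forall>j. v $ j \<le> x $ j)"
      using deg unfolding degree_def by (meson not_le sum_mono)
    then show "F v x = cone_series (add_mset ?e (image_mset (\<lambda>j. axis j 1) (mset_set J))) v x"
      using deg by (auto simp: F_def cone_series_eq_0) (metis ComplI insertE order_refl)
  qed
  with insert.hyps show ?case by (simp add: F_def)
qed

lemma cone_sum_one: "cone_sum (\<lambda>x :: nat ^ 'k::finite. 1 :: 'a::comm_ring_1)"
proof -
  have "0 \<notin># image_mset (\<lambda>j :: 'k. axis j (1 :: nat)) (mset_set UNIV)"
    by (auto simp: axis_def vec_eq_iff) (metis nat.distinct(1))
  then have "cone_sum (cone_series (image_mset (\<lambda>j :: 'k. axis j 1) (mset_set UNIV)) 0 ::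
      ('a, 'k) mseries)"
    by (rule cone_sum.cone)
  moreover have "cone_series (image_mset (\<lambda>j :: 'k. axis j 1) (mset_set UNIV)) 0 = (\<lambda>x. 1 :: 'a)"
    by (intro ext) (subst cone_series_axes, simp_all)
  ultimately show ?thesis by simp
qed

theorem theorem4p9:
  fixes m :: nat
    and a :: "nat \<Rightarrow> 'k::finite \<Rightarrow> int"
    and b :: "nat \<Rightarrow> int"
    and S :: "(nat ^ 'k) set"
  assumes "S = {x. \<forall>i\<in>{1..m}. (\<Sum>j\<in>UNIV. a i j * int (x $ j)) + b i \<ge> 0}"
  shows "nice_rational (char_series S :: ('a::field, 'k) mseries)"
proof -
  define H where "H i = {x :: nat ^ 'k. (\<Sum>j\<in>UNIV. a i j * int (x $ j)) + b i \<ge> 0}" for i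
  \<comment> \<open>Impose the first \<open>n\<close> inequalities; \<open>n = 0\<close> leaves the
    constant series 1, and \<open>n = m\<close> gives \<open>S\<close>.\<close>
  have "cone_sum (char_series {x. \<forall>i\<in>{1..n}. x \<in> H i} :: ('a, 'k) mseries)" for n
  proof (induction n)
    case 0
    then show ?case by (simp add: char_series_def cone_sum_one)
  next
    case (Suc n)
    have "char_series {x. \<forall>i\<in>{1..Suc n}. x \<in> H i} =
        restrict_series (H (Suc n)) (char_series {x. \<forall>i\<in>{1..n}. x \<in> H i} :: ('a, 'k) mseries)"
      by (auto simp: fun_eq_iff char_series_def restrict_series_def atLeastAtMostSuc_conv)
    moreover have "cone_sum \<dots>"
      unfolding H_def[of "Suc n"]
      by (rule cone_sum_restrict[OF _ Suc]) (simp add: distrib_left sum.distrib)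
    ultimately show ?case by simp
  qed
  then show ?thesis
    using assms by (auto simp: H_def intro: nice_rational_cone_sum)
qed

end
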